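(* There exists an integer $k_0$ such that for all integers $k\ge k_0$ the following holds. If $X\subseteq\{0,1\}^k$ is an arbitrary set of vertices of the cube with $|X|\ge 2$, then there exists a Hamiltonian cycle $H$ through $X$ such that $s_k(H)\le 2^{1/k}\sqrt{k}$.
   Context: $|x-y|$ denotes Euclidean distance. A Hamiltonian cycle (tour) $H$ through an $n$-element set $X$, $n\ge 2$, is a cyclic ordering $x_1,\ldots,x_n$ of all points of $X$, with edges $x_ix_{i+1}$, $i=1,\ldots,n$, where $x_{n+1}:=x_1$ (so for $n=2$ the single segment is counted twice). Its scaled cost is $s_k(H)=\left(\sum_{i=1}^n|x_i-x_{i+1}|^k\right)^{1/k}$. *)

theory Defs
  imports "HOL-Analysis.Analysis" "HOL-Library.FuncSet"
begin

text \<open>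
  The dimension \<open>k\<close> is quantified inside the theorem, so points of \<open>k\<close>-dimensional Euclidean
  space are functions on the index set \<open>{..<k}\<close>, extended by \<^const>\<open>undefined\<close> elsewhere
  so that distinct functions are distinct points.
\<close>

definition cube_vertices :: "nat \<Rightarrow> (nat \<Rightarrow> real) set" where
  "cube_vertices k = {..<k} \<rightarrow>\<^sub>E {0, 1}"

definition euclid_dist :: "nat \<Rightarrow> (nat \<Rightarrow> real) \<Rightarrow> (nat \<Rightarrow> real) \<Rightarrow> real" where
  "euclid_dist k x y = L2_set (\<lambda>i. x i - y i) {..<k}"

text \<open>
  A cyclic ordering is represented by a list of its points, read off from any starting point;
  the edge that closes the cycle is supplied by the index arithmetic in \<open>scaled_cost\<close>.
\<close>

definition hamiltonian_cycle :: "'a set \<Rightarrow> 'a list \<Rightarrow> bool" where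
  "hamiltonian_cycle X H \<longleftrightarrow> 2 \<le> card X \<and> distinct H \<and> set H = X"

definition scaled_cost :: "nat \<Rightarrow> (nat \<Rightarrow> real) list \<Rightarrow> real" where
  "scaled_cost k H =
     (\<Sum>i<length H. euclid_dist k (H ! i) (H ! (Suc i mod length H)) ^ k) powr (1 / real k)"

end

theory Submission
  imports Defs "HOL-Real_Asymp.Real_Asymp"
begin

text \<open>
  Take a tour that minimises the sum of the weights \<open>(d/k)^(k/2)\<close> over its edges, where \<open>d\<close> is the
  Hamming length of an edge. If \<open>a\<rightarrow>b\<close> and \<open>a'\<rightarrow>b'\<close> are edges of length at least \<open>d\<close>, then
  replacing them by \<open>aa'\<close> and \<open>bb'\<close> gives another tour, so one of these pairs is at distance at
  least \<open>d\<close>. Hence the edges of length at least \<open>d\<close> form a code in the square of the cube with the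
  maximum metric, and sphere packing bounds their number by \<open>4^k / (k choose r)^2\<close> for \<open>2r < d\<close>.
  For \<open>0.24 k < d \<le> 0.9 k\<close> this makes their total weight exponentially small; for \<open>d \<le> 0.24 k\<close>
  the trivial bound \<open>2^k\<close> on the number of edges suffices. The same exchange shows that at most two
  edges are longer than \<open>0.9 k\<close>, since their tails are pairwise at distance more than \<open>0.7 k\<close>, and
  that two edges of length exactly \<open>k\<close> are inverse to each other, so that the tour has two points.
  Otherwise the long edges weigh at most \<open>1 + (1 - 1/k)^(k/2)\<close>, which stays away from \<open>2\<close>.
\<close>

section \<open>Tours and two-opt exchanges\<close>

definition tour_cost :: "('a \<Rightarrow> 'a \<Rightarrow> real) \<Rightarrow> 'a list \<Rightarrow> real" where
  "tour_cost g H = (\<Sum>i<length H. g (H ! i) (H ! (Suc i mod length H)))"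

text \<open>The recursion is free of index arithmetic, so concatenation and reversal can be treated
  structurally; a tour costs this much plus its closing edge.\<close>

fun path_cost :: "('a \<Rightarrow> 'a \<Rightarrow> real) \<Rightarrow> 'a list \<Rightarrow> real" where
  "path_cost g (x # y # xs) = g x y + path_cost g (y # xs)"
| "path_cost g xs = 0"

lemma path_cost_eq_sum: "path_cost g xs = (\<Sum>i<length xs - 1. g (xs ! i) (xs ! Suc i))"
proof (induction g xs rule: path_cost.induct)
  case (1 g x y xs)
  then show ?case by (simp add: sum.lessThan_Suc_shift del: sum.lessThan_Suc)
qed auto

lemma tour_cost_eq_path_cost:
  assumes "H \<noteq> []"
  shows "tour_cost g H = path_cost g H + g (last H) (hd H)"
proof -
  obtain m where m: "length H = Suc m"
    using assms by (cases "length H") auto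
  have "tour_cost g H = (\<Sum>i<m. g (H ! i) (H ! (Suc i mod Suc m))) + g (H ! m) (H ! 0)"
    by (simp add: tour_cost_def m)
  also have "(\<Sum>i<m. g (H ! i) (H ! (Suc i mod Suc m))) = path_cost g H"
    by (simp add: path_cost_eq_sum m)
  finally show ?thesis
    using assms by (simp add: last_conv_nth hd_conv_nth m)
qed

lemma path_cost_append:
  assumes "xs \<noteq> []" "ys \<noteq> []"
  shows "path_cost g (xs @ ys) = path_cost g xs + g (last xs) (hd ys) + path_cost g ys"
  using assms
proof (induction g xs rule: path_cost.induct)
  case ("2_2" g v)
  then show ?case by (cases ys) auto
qed auto

lemma path_cost_rev:
  assumes "\<And>x y. g x y = g y x"
  shows "path_cost g (rev xs) = path_cost g xs"
proof (induction xs)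
  case (Cons x xs)
  then show ?case
    using assms[of x] by (cases xs) (auto simp: path_cost_append last_rev simp del: append_assoc)
qed simp

lemma tour_cost_append_commute: "tour_cost g (xs @ ys) = tour_cost g (ys @ xs)"
  by (cases "xs = [] \<or> ys = []") (auto simp: tour_cost_eq_path_cost path_cost_append)

text \<open>Reversing \<open>C\<close> keeps the cost of its inner edges because \<open>g\<close> is
  symmetric, so only the two edges joining \<open>C\<close> and \<open>B\<close> change.\<close>

lemma two_opt_exchange:
  assumes "\<And>x y. g x y = g y x" "C \<noteq> []" "B \<noteq> []"
  shows "tour_cost g (rev C @ B) + g (last C) (hd B) + g (last B) (hd C)
       = tour_cost g (C @ B) + g (hd C) (hd B) + g (last B) (last C)"
  using assms(2,3) path_cost_rev[of g C, OF assms(1)]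
  by (simp add: tour_cost_eq_path_cost path_cost_append last_rev hd_rev)

lemma optimal_tour_two_opt:
  assumes sym: "\<And>x y. g x y = g y x"
    and opt: "\<And>H'. distinct H' \<Longrightarrow> set H' = set H \<Longrightarrow> tour_cost g H \<le> tour_cost g H'"
    and H: "distinct H" and ij: "i < j" "j < length H"
  defines "nxt \<equiv> \<lambda>i. Suc i mod length H"
  shows "g (H ! i) (H ! nxt i) + g (H ! j) (H ! nxt j) \<le> g (H ! i) (H ! j) + g (H ! nxt i) (H ! nxt j)"
proof -
  \<comment> \<open>\<open>C\<close> is the stretch of the tour from the successor of
    \<open>i\<close> to \<open>j\<close>; after a rotation the rest is \<open>Q @ P\<close>, running
    from the successor of \<open>j\<close> around to \<open>i\<close>.\<close>
  define P where "P = take (Suc i) H"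
  define C where "C = take (j - i) (drop (Suc i) H)"
  define Q where "Q = drop (Suc j) H"
  have split: "H = P @ C @ Q"
  proof -
    have "drop (Suc i) H = C @ drop (j - i) (drop (Suc i) H)"
      by (simp add: C_def del: drop_drop)
    also have "drop (j - i) (drop (Suc i) H) = Q"
      using ij by (simp add: Q_def)
    finally show ?thesis
      by (metis P_def append_take_drop_id)
  qed
  have ne: "P \<noteq> []" "C \<noteq> []"
    using ij by (auto simp: P_def C_def)
  have hC: "hd C = H ! nxt i"
    using ij by (simp add: C_def nxt_def hd_conv_nth)
  have lC: "last C = H ! j"
    using ij ne by (simp add: C_def last_conv_nth)
  have lB: "last (Q @ P) = H ! i"
    using ij ne by (simp add: P_def last_conv_nth)
  \<comment> \<open>If \<open>j\<close> is the last index, then \<open>Q\<close> is empty and the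
    successor of \<open>j\<close> wraps around to the first point of \<open>P\<close>.\<close>
  have hB: "hd (Q @ P) = H ! nxt j"
  proof (cases "Suc j = length H")
    case True
    then show ?thesis using ij by (cases H) (auto simp: P_def Q_def nxt_def)
  next
    case False
    then show ?thesis using ij by (simp add: Q_def nxt_def hd_append hd_drop_conv_nth)
  qed
  have "tour_cost g H = tour_cost g (C @ Q @ P)"
    using tour_cost_append_commute[of g P "C @ Q"] split by simp
  moreover have "tour_cost g H \<le> tour_cost g (rev C @ Q @ P)"
    using H by (intro opt) (auto simp: split)
  ultimately show ?thesis
    using two_opt_exchange[of g C "Q @ P", OF sym] ne sym[of "H ! j" "H ! nxt j"]
    unfolding hC lC lB hB by simp
qed

section \<open>Packing in the cube\<close>

lemma card_sym_diff_triangle: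
  assumes "finite A" "finite B" "finite C"
  shows "card (sym_diff A C) \<le> card (sym_diff A B) + card (sym_diff B C)"
proof -
  have "card (sym_diff A C) \<le> card (sym_diff A B \<union> sym_diff B C)"
    using assms by (intro card_mono) auto
  also have "\<dots> \<le> card (sym_diff A B) + card (sym_diff B C)"
    by (rule card_Un_le)
  finally show ?thesis .
qed

text \<open>Going around the triangle, membership of a point changes an even number of times, so
  each point of \<open>U\<close> lies in at most two of the three differences.\<close>

lemma card_sym_diff_perimeter:
  assumes "finite U" "A \<subseteq> U" "B \<subseteq> U" "C \<subseteq> U"
  shows "card (sym_diff A B) + card (sym_diff B C) + card (sym_diff A C) \<le> 2 * card U"
proof -
  have fin: "finite A" "finite B" "finite C"
    using assms finite_subset by blast+
  have "card (sym_diff A B) + card (sym_diff B C)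
      = card (sym_diff A B \<union> sym_diff B C) + card (sym_diff A B \<inter> sym_diff B C)"
    using fin by (intro card_Un_Int) auto
  moreover have "card (sym_diff A B \<inter> sym_diff B C) + card (sym_diff A C)
      = card ((sym_diff A B \<inter> sym_diff B C) \<union> sym_diff A C)"
    using fin by (intro card_Un_disjoint [symmetric]) auto
  moreover have "card (sym_diff A B \<union> sym_diff B C) \<le> card U"
    "card ((sym_diff A B \<inter> sym_diff B C) \<union> sym_diff A C) \<le> card U"
    using assms by (intro card_mono; auto)+
  ultimately show ?thesis by linarith
qed

text \<open>Hamming bound in the square of the cube with the maximum metric. Spheres of radius
  exactly \<open>r\<close> replace balls, so that a single binomial coefficient appears instead of a
  sum.\<close>

lemma sphere_packing_pairs:
  fixes a b :: "'i \<Rightarrow> 'a set"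
  assumes U: "finite U" and I: "finite I"
    and sub: "\<And>i. i \<in> I \<Longrightarrow> a i \<subseteq> U" "\<And>i. i \<in> I \<Longrightarrow> b i \<subseteq> U"
    and far: "\<And>i j. i \<in> I \<Longrightarrow> j \<in> I \<Longrightarrow> i \<noteq> j \<Longrightarrow>
           2 * r < card (sym_diff (a i) (a j)) \<or> 2 * r < card (sym_diff (b i) (b j))"
  shows "card I * (card U choose r)\<^sup>2 \<le> 4 ^ card U"
proof -
  define S where "S = {T. T \<subseteq> U \<and> card T = r}"
  have S: "finite S" "card S = card U choose r" "\<And>T. T \<in> S \<Longrightarrow> finite T"
    using U n_subsets[OF U] by (auto simp: S_def intro: finite_subset)
  have near: "card (sym_diff A A') \<le> 2 * r"
    if "T \<in> S" "T' \<in> S" "sym_diff A T = sym_diff A' T'" for A A' T T'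
  proof -
    have "sym_diff A A' = sym_diff T T'"
      using that(3) by blast
    moreover have "card (sym_diff T {}) + card (sym_diff {} T') \<le> 2 * r"
      using that by (simp add: S_def)
    ultimately show ?thesis
      using card_sym_diff_triangle[of T "{}" T'] that S(3) by simp
  qed
  \<comment> \<open>\<open>h\<close> enumerates the products of spheres around the pairs; distance at least \<open>2 * r + 1\<close> makes them disjoint.\<close>
  define h where "h = (\<lambda>(i, T, T'). (sym_diff (a i) T, sym_diff (b i) T'))"
  have "inj_on h (I \<times> S \<times> S)"
  proof (rule inj_onI)
    fix u v assume uv: "u \<in> I \<times> S \<times> S" "v \<in> I \<times> S \<times> S" "h u = h v"
    obtain i T1 T2 j T3 T4 where [simp]: "u = (i, T1, T2)" "v = (j, T3, T4)"
      by (metis prod_cases3)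
    have eq: "sym_diff (a i) T1 = sym_diff (a j) T3" "sym_diff (b i) T2 = sym_diff (b j) T4"
      using uv by (simp_all add: h_def)
    have "i = j"
      using far[of i j] near[of T1 T3 "a i" "a j"] near[of T2 T4 "b i" "b j"] eq uv by force
    moreover from this eq have "T1 = T3" "T2 = T4" by blast+
    ultimately show "u = v" by simp
  qed
  moreover have "h ` (I \<times> S \<times> S) \<subseteq> Pow U \<times> Pow U"
    using sub by (fastforce simp: h_def S_def)
  ultimately have "card (I \<times> S \<times> S) \<le> card (Pow U \<times> Pow U)"
    using U by (intro card_inj_on_le) auto
  then show ?thesis
    using S(2) by (simp add: card_cartesian_product card_Pow[OF U] power2_eq_square
        flip: power_mult_distrib)
qed

text \<open>A sum of \<open>k + 1\<close> terms is at most \<open>k + 1\<close> times its largest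
  term. Divided by \<open>k ^ k\<close>, this is the entropy lower bound on
  \<open>k choose r\<close> up to a polynomial factor.\<close>

lemma power_self_le_binomial_max_term:
  assumes "r \<le> k"
  shows "k ^ k \<le> (k + 1) * ((k choose r) * r ^ r * (k - r) ^ (k - r))"
proof -
  \<comment> \<open>The terms of the expansion of \<open>(r + (k - r))^k\<close>, the largest of which is \<open>t r\<close>.\<close>
  define t where "t i = (k choose i) * r ^ i * (k - r) ^ (k - i)" for i
  \<comment> \<open>The ratio of consecutive terms, cross-multiplied to stay in the natural numbers;
    comparing the two factors shows that \<open>t\<close> rises up to \<open>r\<close> and falls
    afterwards.\<close>
  have ratio: "t i * ((k - i) * r) = t (Suc i) * (Suc i * (k - r))" if "i < k" for i
  proof -
    have "Suc i * (k choose Suc i) = (k - i) * (k choose i)"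
      by (metis binomial_absorb_comp binomial_absorption)
    moreover have "k - i = Suc (k - Suc i)" using that by simp
    ultimately show ?thesis unfolding t_def
      by (smt (verit, best) mult.assoc mult.commute mult.left_commute power_Suc)
  qed
  have up: "t i \<le> t (Suc i)" if "i < r" for i
  proof -
    have "(k - r) * Suc i \<le> (k - i) * r"
      using that by (intro mult_mono) auto
    then have "t i * ((k - i) * r) \<le> t (Suc i) * ((k - i) * r)"
      using ratio[of i] that assms by (simp add: mult.commute)
    then show ?thesis using that assms by simp
  qed
  have down: "t (Suc i) \<le> t i" if "r \<le> i" "i < k" for i
  proof -
    have "(k - i) * r \<le> (k - r) * Suc i"
      using that by (intro mult_mono) auto
    then have "t (Suc i) * (Suc i * (k - r)) \<le> t i * (Suc i * (k - r))"
      using ratio[of i, symmetric] that by (simp add: mult.commute)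
    then show ?thesis using that by simp
  qed
  have "t i \<le> t r" if "i \<le> k" for i
  proof (cases "i \<le> r")
    case True
    then show ?thesis
      by (induction rule: inc_induct) (use up in \<open>auto intro: order_trans\<close>)
  next
    case False
    then have "r \<le> i" by simp
    then show ?thesis using that
      by (induction rule: dec_induct) (use down in \<open>fastforce intro: order_trans\<close>)+
  qed
  then have "(\<Sum>i\<le>k. t i) \<le> (\<Sum>i\<le>k. t r)"
    by (intro sum_mono) auto
  moreover have "(\<Sum>i\<le>k. t i) = k ^ k"
    using binomial[of r "k - r" k] assms by (simp add: t_def)
  ultimately show ?thesis by (simp add: t_def)
qed

section \<open>The exponential rate of the packing bound\<close>

text \<open>
  Up to lower-order terms, \<open>4^k / (k choose r)^2\<close> edges of length \<open>2r\<close> have total weight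
  \<open>exp (k * rate p)\<close> with \<open>p = r/k\<close>. The function vanishes at \<open>1/2\<close> and has its inflection point
  at \<open>1/5\<close>: to the right of it convexity gives negativity, to the left a tangent close to the maximum does.
\<close>

definition rate :: "real \<Rightarrow> real" where
  "rate p = 2 * ln 2 + 2 * (p * ln p) + 2 * ((1 - p) * ln (1 - p)) + ln (2 * p) / 2"

lemma rate_has_derivative:
  assumes "0 < p" "p < 1"
  shows "(rate has_real_derivative 2 * ln p - 2 * ln (1 - p) + 1 / (2 * p)) (at p)"
    and "((\<lambda>p. 2 * ln p - 2 * ln (1 - p) + 1 / (2 * p)) has_real_derivative
           (5 * p - 1) / (2 * p\<^sup>2 * (1 - p))) (at p)"
proof -
  have *: "2 + p * 2 / (1 - p) = 2 / (1 - p)"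
    using assms by (simp add: field_simps)
  show "(rate has_real_derivative 2 * ln p - 2 * ln (1 - p) + 1 / (2 * p)) (at p)"
    using assms unfolding rate_def
    by (auto intro!: derivative_eq_intros simp: algebra_simps *)
  show "((\<lambda>p. 2 * ln p - 2 * ln (1 - p) + 1 / (2 * p)) has_real_derivative
           (5 * p - 1) / (2 * p\<^sup>2 * (1 - p))) (at p)"
    using assms
    by (auto intro!: derivative_eq_intros simp: field_simps power2_eq_square)
qed

lemma rate_neg_upper:
  assumes "1/5 \<le> p" "p < 1/2"
  shows "rate p < 0"
proof -
  have "convex_on {1/5..1/2} rate"
    by (rule f''_ge0_imp_convex[OF _ rate_has_derivative]) auto
  moreover have "rate (1/2) = 0"
    by (simp add: rate_def ln_div)
  moreover have "rate (1/5) < 0"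
  proof -
    \<comment> \<open>\<open>10 * rate (1/5)\<close> equals \<open>57 * ln 2 - 25 * ln 5\<close>, so
      its sign is decided by comparing two integers.\<close>
    have "ln (2 ^ 57) < (ln (5 ^ 25) :: real)"
      by (subst ln_less_cancel_iff) simp_all
    then have "57 * ln 2 < (25 * ln 5 :: real)"
      by (simp only: ln_realpow zero_less_numeral of_nat_numeral)
    moreover have "ln 4 = (2 * ln 2 :: real)"
      using ln_realpow[of 2 2] by simp
    ultimately show ?thesis by (simp add: rate_def ln_div field_simps)
  qed
  moreover obtain u where u: "0 < u" "u \<le> 1" "p = (1 - (1 - u)) * (1/5) + (1 - u) * (1/2)"
  proof
    show "p = (1 - (1 - (5/3 - 10/3 * p))) * (1/5) + (1 - (5/3 - 10/3 * p)) * (1/2)"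
      by (simp add: field_simps)
  qed (use assms in auto)
  ultimately have "rate p \<le> u * rate (1/5)"
    using convex_onD[of "{1/5..1/2}" rate "1 - u" "1/5" "1/2"] by simp
  also have "\<dots> < 0"
    using u(1) \<open>rate (1/5) < 0\<close> by (simp add: mult_pos_neg)
  finally show ?thesis .
qed

lemma rate_neg_lower:
  assumes "11/100 \<le> p" "p \<le> 1/5"
  shows "rate p < 0"
proof -
  \<comment> \<open>The slope of \<open>rate\<close> at \<open>1/7\<close>, a rational point near
    the maximum; the slope is shown below to lie between -1 and 0.\<close>
  define s :: real where "s = 7/2 - 2 * ln 6"
  have "convex_on {0<..1/5} (\<lambda>p. - rate p)"
    by (rule f''_ge0_imp_convex[OF _ DERIV_minus[OF rate_has_derivative(1)]
          DERIV_minus[OF rate_has_derivative(2)]]) (auto simp: divide_le_0_iff)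
  moreover have "((\<lambda>p. - rate p) has_real_derivative - s) (at (1/7) within {0<..1/5})"
  proof (rule has_field_derivative_at_within, rule DERIV_minus)
    have "2 * ln (1/7) - 2 * ln (1 - 1/7) + 1 / (2 * (1/7)) = s"
      by (simp add: s_def ln_div)
    moreover have "0 < (1/7::real)" "(1/7::real) < 1"
      by simp_all
    ultimately show "(rate has_real_derivative s) (at (1/7))"
      using rate_has_derivative(1)[of "1/7"] by metis
  qed
  moreover have "1/7 \<in> interior {0<..1/5::real}"
    by (rule interior_maximal[THEN subsetD, of "{0<..<1/5}"]) auto
  moreover have "connected {0<..1/5::real}"
    by simp
  ultimately have "(- rate p) - (- rate (1/7)) \<ge> - s * (p - 1/7)"
    using assms by (intro convex_on_imp_above_tangent) auto
  moreover have "rate (1/7) < - (1/28)"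
  proof -
    \<comment> \<open>\<open>14 * rate (1/7)\<close> equals
      \<open>59 * ln 2 + 24 * ln 3 - 35 * ln 7\<close>; the spare factor 2 pushes it below
      \<open>- ln 2\<close>, hence below \<open>-1/2\<close>.\<close>
    have "ln (2 * 2 ^ 59 * 3 ^ 24) < (ln (7 ^ 35) :: real)"
      by (subst ln_less_cancel_iff) simp_all
    then have "ln 2 + 59 * ln 2 + 24 * ln 3 < (35 * ln 7 :: real)"
      by (simp only: ln_realpow ln_mult zero_less_numeral of_nat_numeral mult_pos_pos zero_less_power) simp
    moreover have "ln 6 = (ln 2 + ln 3 :: real)"
      using ln_mult[of 2 "3::real"] by simp
    ultimately show ?thesis
      using ln2_ge_two_thirds by (simp add: rate_def ln_div field_simps)
  qed
  moreover have "s \<le> 0"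
  proof -
    have "exp 7 = exp (1::real) ^ 7"
      by (simp flip: exp_of_nat_mult)
    also have "\<dots> \<le> (272/100) ^ 7"
      using e_less_272 by (intro power_mono) auto
    also have "\<dots> \<le> 6 ^ 4"
      by (simp add: power_numeral_reduce)
    finally have "7 \<le> ln (6 ^ 4 :: real)"
      by (subst ln_ge_iff) auto
    then show ?thesis by (simp add: s_def ln_realpow del: power_numeral)
  qed
  moreover have "s \<ge> -1"
  proof -
    have "6 \<le> (1 + 9/32 :: real) ^ 8"
      by (simp add: power_numeral_reduce)
    also have "\<dots> \<le> exp (9/32) ^ 8"
      by (intro power_mono exp_ge_add_one_self) auto
    also have "\<dots> = exp (9/4)"
      by (simp flip: exp_of_nat_mult)
    finally have "ln 6 \<le> ln (exp (9/4 :: real))"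
      by (subst ln_le_cancel_iff) auto
    then show ?thesis by (simp add: s_def)
  qed
  \<comment> \<open>The tangent exceeds its value at \<open>1/7\<close> by at most
    \<open>1/7 - 11/100 < 33/1000\<close>, which is less than the margin
    \<open>1/28\<close>.\<close>
  moreover have "s * (p - 1/7) \<le> 33/1000"
  proof (cases "p \<le> 1/7")
    case True
    then have "(- s) * (1/7 - p) \<le> 1 * (33/1000)"
      using assms \<open>s \<le> 0\<close> \<open>s \<ge> -1\<close> by (intro mult_mono) auto
    then show ?thesis by (simp add: algebra_simps)
  next
    case False
    then show ?thesis
      using \<open>s \<le> 0\<close> mult_nonpos_nonneg[of s "p - 1/7"] by linarith
  qed
  ultimately show ?thesis by linarith
qed

text \<open>Compactness turns pointwise negativity into a uniform gap. For
  \<open>0.24 k < d \<le> 0.9 k\<close> and \<open>k \<ge> 100\<close>, the packing radius divided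
  by \<open>k\<close> falls into this interval.\<close>

lemma rate_bound: "\<exists>\<eta>>0. \<forall>p\<in>{11/100..45/100}. rate p \<le> - \<eta>"
proof -
  have "continuous_on {11/100..45/100} rate"
    by (intro continuous_at_imp_continuous_on ballI DERIV_isCont[OF rate_has_derivative(1)]) auto
  then obtain q where "q \<in> {11/100..45/100}" "\<forall>p\<in>{11/100..45/100}. rate p \<le> rate q"
    using continuous_attains_sup[of "{11/100..45/100::real}" rate] by auto
  then show ?thesis
    using rate_neg_lower[of q] rate_neg_upper[of q] by (intro exI[of _ "- rate q"]) force
qed

text \<open>The factor \<open>(k + 1) ^ 2\<close> comes from squaring the lower bound on the
  binomial coefficient, and \<open>k / (2 * r)\<close> pays for \<open>d\<close> exceeding
  \<open>2 * r\<close> by up to 2.\<close>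

lemma binomial_rate_bound:
  assumes r: "0 < r" "r < k" and d: "real d \<le> 2 * real r + 2"
  shows "4 ^ k / real (k choose r) ^ 2 * sqrt (real d / real k) ^ k
      \<le> real (k + 1) ^ 2 * exp (k * rate (r / k) + real k / (2 * real r))"
proof -
  define p where "p = real r / real k"
  have p: "0 < p" "p < 1" and k: "0 < k" using r by (auto simp: p_def)
  have r_eq: "real r = k * p" and kr_eq: "real (k - r) = k * (1 - p)"
    using r by (auto simp: p_def field_simps of_nat_diff)
  define E where "E = exp (k * (p * ln p + (1 - p) * ln (1 - p)))"
  have E: "1 \<le> real (k + 1) * real (k choose r) * E"
  proof -
    have "real r ^ r * real (k - r) ^ (k - r) = real k ^ k * E"
    proof -
      have "real r ^ r * real (k - r) ^ (k - r) = real k ^ (r + (k - r)) * (p ^ r * (1 - p) ^ (k - r))"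
        unfolding r_eq kr_eq by (simp add: power_mult_distrib power_add)
      also have "p ^ r * (1 - p) ^ (k - r) = p powr r * (1 - p) powr (k - r)"
        using p by (simp add: powr_realpow)
      also have "\<dots> = E"
        using p by (simp add: powr_def E_def r_eq kr_eq algebra_simps flip: exp_add)
      finally show ?thesis using r by simp
    qed
    moreover have "real k ^ k \<le> real (k + 1) * (real (k choose r) * (real r ^ r * real (k - r) ^ (k - r)))"
      using of_nat_mono[OF power_self_le_binomial_max_term[of r k], where 'a = real] r
      by (simp only: of_nat_mult of_nat_power mult.assoc less_imp_le)
    ultimately have "real k ^ k * 1 \<le> real k ^ k * (real (k + 1) * real (k choose r) * E)"
      by (simp add: mult_ac)
    then show ?thesis using k by (simp only: mult_le_cancel_left_pos zero_less_power of_nat_0_less_iff)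
  qed
  have c: "0 < real (k choose r)" using r by simp
  have "1 / real (k choose r) \<le> real (k + 1) * E"
    using E c by (simp add: field_simps)
  then have "(1 / real (k choose r)) ^ 2 \<le> (real (k + 1) * E) ^ 2"
    using c by (intro power_mono) auto
  then have 1: "4 ^ k / real (k choose r) ^ 2 \<le> 4 ^ k * (real (k + 1) ^ 2 * E ^ 2)"
    using mult_left_mono[of _ _ "4 ^ k :: real"] by (fastforce simp: power_divide power_mult_distrib)
  have 2: "sqrt (real d / real k) ^ k \<le> exp (k * (ln (2 * p) / 2) + real k / (2 * real r))"
  proof -
    have "real d / real k \<le> (2 * real r + 2) / real k"
      using d by (rule divide_right_mono) simp
    also have "\<dots> = 2 * p * (1 + 1 / r)"
      using r k by (simp add: p_def field_simps)
    also have "\<dots> \<le> 2 * p * exp (1 / r)"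
      using p by (intro mult_left_mono exp_ge_add_one_self) auto
    also have "\<dots> = exp (ln (2 * p) + 1 / r)"
      using p by (simp add: exp_add)
    also have "\<dots> = exp ((ln (2 * p) + 1 / r) / 2) ^ 2"
      by (simp flip: exp_of_nat_mult)
    finally have "sqrt (real d / real k) \<le> exp ((ln (2 * p) + 1 / r) / 2)"
      by (intro real_le_lsqrt) auto
    then have "sqrt (real d / real k) ^ k \<le> exp ((ln (2 * p) + 1 / r) / 2) ^ k"
      by (intro power_mono) auto
    also have "\<dots> = exp (k * (ln (2 * p) / 2) + real k / (2 * real r))"
      by (simp add: algebra_simps add_divide_distrib flip: exp_of_nat_mult)
    finally show ?thesis .
  qed
  have four: "(4::real) ^ k = exp (k * (2 * ln 2))"
  proof -
    have "exp (k * (2 * ln 2)) = exp (2 * ln (2::real)) ^ k"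
      by (rule exp_of_nat_mult)
    also have "exp (2 * ln (2::real)) = 4"
      by (subst exp_double) simp
    finally show ?thesis by (rule sym)
  qed
  have "4 ^ k / real (k choose r) ^ 2 * sqrt (real d / real k) ^ k
     \<le> 4 ^ k * (real (k + 1) ^ 2 * E ^ 2) * exp (k * (ln (2 * p) / 2) + real k / (2 * real r))"
    by (rule mult_mono[OF 1 2]) (simp_all add: zero_le_mult_iff)
  also have "\<dots> = real (k + 1) ^ 2 * (exp (k * (2 * ln 2)) * exp (2 * (k * (p * ln p + (1 - p) * ln (1 - p))))
      * exp (k * (ln (2 * p) / 2) + real k / (2 * real r)))"
    unfolding four E_def exp_double by (simp only: mult.assoc mult.left_commute)
  also have "\<dots> = real (k + 1) ^ 2 * exp (k * (2 * ln 2) + 2 * (k * (p * ln p + (1 - p) * ln (1 - p)))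
      + (k * (ln (2 * p) / 2) + real k / (2 * real r)))"
    by (simp only: exp_add)
  also have "k * (2 * ln 2) + 2 * (k * (p * ln p + (1 - p) * ln (1 - p)))
      + (k * (ln (2 * p) / 2) + real k / (2 * real r)) = k * rate p + real k / (2 * real r)"
    by (simp add: rate_def distrib_left)
  finally show ?thesis unfolding p_def .
qed

section \<open>Edge lengths in a two-opt tour\<close>

text \<open>Normalised so that a full diagonal of the cube weighs 1; the theorem then asks for total
  weight at most 2.\<close>

definition weight :: "nat \<Rightarrow> nat \<Rightarrow> real" where
  "weight k d = sqrt (real d / real k) ^ k"

lemma weight_strict_mono: "0 < k \<Longrightarrow> d < d' \<Longrightarrow> weight k d < weight k d'"
  unfolding weight_def by (intro power_strict_mono) (auto simp: divide_strict_right_mono)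

lemma weight_mono: "d \<le> d' \<Longrightarrow> weight k d \<le> weight k d'"
  unfolding weight_def by (intro power_mono) (auto simp: divide_right_mono)

lemma weight_self: "0 < k \<Longrightarrow> weight k k = 1"
  by (simp add: weight_def)

text \<open>The square of this weight is \<open>(1 - 1/k) ^ k \<le> 1/e\<close>, which is below
  \<open>9/16\<close>.\<close>

lemma weight_pred_self:
  assumes "0 < k"
  shows "weight k (k - 1) \<le> 3/4"
proof -
  have "(real (k - 1) / real k) ^ k = (1 - 1 / real k) ^ k"
    using assms by (simp add: of_nat_diff diff_divide_distrib)
  also have "\<dots> \<le> exp (- 1 / real k) ^ k"
    using assms exp_ge_add_one_self[of "- 1 / real k"] by (intro power_mono) auto
  also have "\<dots> = exp (- 1)"
    using assms by (simp flip: exp_of_nat_mult)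
  also have "\<dots> \<le> 1 / 2"
    using exp_ge_add_one_self[of "1 :: real"] by (simp add: exp_minus field_simps)
  also have "\<dots> \<le> (3/4)\<^sup>2"
    by (simp add: power2_eq_square)
  finally have "sqrt ((real (k - 1) / real k) ^ k) \<le> 3/4"
    by (intro real_le_lsqrt) auto
  then show ?thesis
    by (simp add: weight_def real_sqrt_power)
qed

lemma sym_diff_full_unique:
  assumes "finite U" "A \<subseteq> U" "B \<subseteq> U" "C \<subseteq> U"
    and "card U \<le> card (sym_diff A B)" "card U \<le> card (sym_diff A C)"
  shows "B = C"
proof -
  have "card (sym_diff B C) = 0"
    using card_sym_diff_perimeter[of U A B C] assms by linarith
  moreover have "finite (sym_diff B C)"
    using assms finite_subset by blast
  ultimately show ?thesis by auto
qed

text \<open>Vertices are represented by their supports, so lengths are sizes of symmetric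
  differences. Of the optimality of the tour only the local exchange inequality is kept.\<close>

locale two_opt_tour =
  fixes k n :: nat and a :: "nat \<Rightarrow> nat set"
  assumes k_pos: "0 < k" and two_le_n: "2 \<le> n"
    and inj: "inj_on a {..<n}"
    and sub: "i < n \<Longrightarrow> a i \<subseteq> {..<k}"
    and two_opt: "i < n \<Longrightarrow> j < n \<Longrightarrow> i \<noteq> j \<Longrightarrow>
      weight k (card (sym_diff (a i) (a (Suc i mod n)))) + weight k (card (sym_diff (a j) (a (Suc j mod n))))
      \<le> weight k (card (sym_diff (a i) (a j)))
        + weight k (card (sym_diff (a (Suc i mod n)) (a (Suc j mod n))))"
begin

definition b :: "nat \<Rightarrow> nat set" where "b i = a (Suc i mod n)"

definition D :: "nat \<Rightarrow> nat" where "D i = card (sym_diff (a i) (b i))"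

lemma sub_b: "i < n \<Longrightarrow> b i \<subseteq> {..<k}"
  unfolding b_def using two_le_n by (intro sub) simp

lemma finite_ab: "i < n \<Longrightarrow> finite (a i)" "i < n \<Longrightarrow> finite (b i)"
  by (meson finite_lessThan finite_subset sub sub_b)+

lemma D_le: assumes "i < n" shows "D i \<le> k"
proof -
  have "D i \<le> card {..<k}"
    unfolding D_def using sub[OF assms] sub_b[OF assms] by (intro card_mono) auto
  then show ?thesis by simp
qed

text \<open>If both new edges were shorter than \<open>d\<close>, strict monotonicity of
  \<open>weight\<close> would make the exchange a strict gain.\<close>

lemma far_ends:
  assumes "i < n" "j < n" "i \<noteq> j" "d \<le> D i" "d \<le> D j"
  shows "d \<le> card (sym_diff (a i) (a j)) \<or> d \<le> card (sym_diff (b i) (b j))"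
proof (rule ccontr)
  assume "\<not> ?thesis"
  then have "weight k (card (sym_diff (a i) (a j))) < weight k d"
    "weight k (card (sym_diff (b i) (b j))) < weight k d"
    by (auto intro!: weight_strict_mono k_pos)
  moreover have "weight k d \<le> weight k (D i)" "weight k d \<le> weight k (D j)"
    using assms by (auto intro!: weight_mono)
  ultimately show False
    using two_opt[OF assms(1-3)] by (simp add: D_def b_def)
qed

section \<open>Counting and weighing the edges of length at most 0.9 k\<close>

lemma card_edges_of_length:
  assumes "2 * r < d"
  shows "card {i. i < n \<and> D i = d} * (k choose r)\<^sup>2 \<le> 4 ^ k"
proof -
  have "card {i. i < n \<and> D i = d} * (card {..<k} choose r)\<^sup>2 \<le> 4 ^ card {..<k}"
  proof (rule sphere_packing_pairs)
    fix i j assume "i \<in> {i. i < n \<and> D i = d}" "j \<in> {i. i < n \<and> D i = d}" "i \<noteq> j"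
    then show "2 * r < card (sym_diff (a i) (a j)) \<or> 2 * r < card (sym_diff (b i) (b j))"
      using far_ends[of i j d] assms by auto
  qed (use sub sub_b in auto)
  then show ?thesis by simp
qed

lemma n_le: "n \<le> 2 ^ k"
  using card_inj_on_le[OF inj, of "Pow {..<k}"] sub by (auto simp: card_Pow)

text \<open>There are at most \<open>2 ^ k\<close> edges in all. The threshold \<open>24/100\<close>
  lies below \<open>1/4\<close>, so that the base \<open>2 * sqrt (24/100)\<close> is below
  1.\<close>

lemma short_edges:
  "(\<Sum>i | i < n \<and> 100 * D i \<le> 24 * k. weight k (D i)) \<le> (2 * sqrt (24/100)) ^ k"
proof -
  have "(\<Sum>i | i < n \<and> 100 * D i \<le> 24 * k. weight k (D i))
      \<le> real (card {i. i < n \<and> 100 * D i \<le> 24 * k}) * sqrt (24/100) ^ k"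
    unfolding weight_def using k_pos
    by (intro sum_bounded_above power_mono) (auto simp: field_simps)
  also have "\<dots> \<le> 2 ^ k * sqrt (24/100) ^ k"
  proof (intro mult_right_mono)
    have "card {i. i < n \<and> 100 * D i \<le> 24 * k} \<le> card {..<n}"
      by (intro card_mono) auto
    then have "card {i. i < n \<and> 100 * D i \<le> 24 * k} \<le> 2 ^ k"
      using n_le by simp
    then show "real (card {i. i < n \<and> 100 * D i \<le> 24 * k}) \<le> 2 ^ k"
      by (metis of_nat_le_iff of_nat_numeral of_nat_power)
  qed simp
  finally show ?thesis by (simp add: power_mult_distrib)
qed

lemma edges_of_medium_length:
  assumes \<eta>: "\<And>p. p \<in> {11/100..45/100} \<Longrightarrow> rate p \<le> - \<eta>"
    and k: "100 \<le> k" and d: "24 * k < 100 * d" "10 * d \<le> 9 * k"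
  shows "(\<Sum>i | i < n \<and> D i = d. weight k (D i)) \<le> real (k + 1) ^ 2 * exp (5 - \<eta> * k)"
proof -
  \<comment> \<open>The largest \<open>r\<close> with \<open>2 * r < d\<close>. Rounding loses at
    most 1 from \<open>d / 2 > 0.12 k\<close>, so \<open>k \<ge> 100\<close> leaves
    \<open>r \<ge> 0.11 k\<close>.\<close>
  define r where "r = (d - 1) div 2"
  have r: "2 * r < d" "d \<le> 2 * r + 2" "11 * k \<le> 100 * r" "100 * r \<le> 45 * k" "0 < r" "r < k"
    using k d by (auto simp: r_def)
  have c: "0 < real (k choose r)"
    using r by simp
  have "real (card {i. i < n \<and> D i = d}) * real (k choose r) ^ 2 \<le> 4 ^ k"
    using of_nat_mono[OF card_edges_of_length[OF r(1)], where 'a = real] by simp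
  then have "real (card {i. i < n \<and> D i = d}) \<le> 4 ^ k / real (k choose r) ^ 2"
    using c by (simp add: field_simps)
  then have "real (card {i. i < n \<and> D i = d}) * weight k d \<le> 4 ^ k / real (k choose r) ^ 2 * weight k d"
    by (rule mult_right_mono) (simp add: weight_def)
  then have "(\<Sum>i | i < n \<and> D i = d. weight k (D i)) \<le> 4 ^ k / real (k choose r) ^ 2 * weight k d"
    by simp
  also have "\<dots> \<le> real (k + 1) ^ 2 * exp (k * rate (r / k) + real k / (2 * real r))"
    unfolding weight_def using r by (intro binomial_rate_bound) auto
  also have "\<dots> \<le> real (k + 1) ^ 2 * exp (5 - \<eta> * k)"
  proof -
    have "rate (r / k) \<le> - \<eta>"
      using r k by (intro \<eta>) (auto simp: field_simps)
    then have "k * rate (r / k) \<le> k * (- \<eta>)"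
      by (intro mult_left_mono) auto
    moreover have "real k / (2 * real r) \<le> 5"
      using r by (simp add: field_simps)
    ultimately show ?thesis by (simp add: mult.commute)
  qed
  finally show ?thesis .
qed

lemma medium_edges:
  assumes \<eta>: "\<And>p. p \<in> {11/100..45/100} \<Longrightarrow> rate p \<le> - \<eta>" and k: "100 \<le> k"
  shows "(\<Sum>i | i < n \<and> 24 * k < 100 * D i \<and> 10 * D i \<le> 9 * k. weight k (D i))
      \<le> real (k + 1) ^ 3 * exp (5 - \<eta> * k)"
proof -
  define S where "S = {i. i < n \<and> 24 * k < 100 * D i \<and> 10 * D i \<le> 9 * k}"
  \<comment> \<open>Grouping by exact length leaves at most \<open>k + 1\<close> classes, which
    accounts for the third factor \<open>k + 1\<close>.\<close>
  have "(\<Sum>i\<in>S. weight k (D i)) = (\<Sum>d\<le>k. \<Sum>i | i \<in> S \<and> D i = d. weight k (D i))"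
  proof (rule sum.group[of S "{..k}" D, symmetric])
    show "D ` S \<subseteq> {..k}"
      using D_le by (auto simp: S_def)
  qed (simp_all add: S_def)
  also have "\<dots> \<le> (\<Sum>d\<le>k. real (k + 1) ^ 2 * exp (5 - \<eta> * k))"
  proof (intro sum_mono)
    fix d
    show "(\<Sum>i | i \<in> S \<and> D i = d. weight k (D i)) \<le> real (k + 1) ^ 2 * exp (5 - \<eta> * k)"
    proof (cases "24 * k < 100 * d \<and> 10 * d \<le> 9 * k")
      case True
      then have "{i. i \<in> S \<and> D i = d} = {i. i < n \<and> D i = d}"
        by (auto simp: S_def)
      then show ?thesis using edges_of_medium_length[OF \<eta> k] True by simp
    next
      case False
      then have *: "{i. i \<in> S \<and> D i = d} = {}"
        by (auto simp: S_def)
      show ?thesis unfolding * by simp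
    qed
  qed
  finally show ?thesis
    by (simp add: S_def power_numeral_reduce algebra_simps)
qed

section \<open>Edges longer than 0.9 k\<close>

lemma card_long_edges: "card {i. i < n \<and> 9 * k < 10 * D i} \<le> 2"
proof (rule ccontr)
  assume "\<not> ?thesis"
  then have "3 \<le> card {i. i < n \<and> 9 * k < 10 * D i}" by simp
  then obtain T where T: "T \<subseteq> {i. i < n \<and> 9 * k < 10 * D i}" "card T = 3"
    by (rule obtain_subset_with_card_n)
  obtain x y z where xyz: "T = {x, y, z}" "x \<noteq> y" "y \<noteq> z" "x \<noteq> z"
    using T(2) by (metis card_3_iff)
  \<comment> \<open>Either the tails are more than \<open>0.9 k\<close> apart, or the heads are. In
    the second case the perimeter bound puts \<open>a i\<close> within \<open>0.2 k\<close> of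
    \<open>b j\<close>, and the triangle inequality through \<open>b j\<close> gives
    \<open>0.7 k\<close>.\<close>
  have far: "7 * k < 10 * card (sym_diff (a i) (a j))" if "i \<in> T" "j \<in> T" "i \<noteq> j" for i j
  proof -
    have ij: "i < n" "j < n" "9 * k < 10 * D i" "9 * k < 10 * D j"
      using that T by auto
    have "D i + card (sym_diff (b i) (b j)) + card (sym_diff (a i) (b j)) \<le> 2 * k"
      using card_sym_diff_perimeter[of "{..<k}" "a i" "b i" "b j"] sub sub_b ij by (simp add: D_def)
    moreover have "D j \<le> card (sym_diff (a i) (a j)) + card (sym_diff (a i) (b j))"
      unfolding D_def Un_commute[of "a i - a j" "a j - a i"]
      using finite_ab ij by (intro card_sym_diff_triangle)
    moreover have "D i \<le> m \<or> D j \<le> m"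
      if "m = max (card (sym_diff (a i) (a j))) (card (sym_diff (b i) (b j)))" for m
      using far_ends[of i j "min (D i) (D j)"] ij \<open>i \<noteq> j\<close> that by (auto simp: le_max_iff_disj min_le_iff_disj)
    ultimately show ?thesis
      using ij(3,4) by (auto simp: max_def split: if_splits)
  qed
  have "x < n" "y < n" "z < n" "x \<in> T" "y \<in> T" "z \<in> T"
    using T(1) xyz(1) by blast+
  \<comment> \<open>Three tails pairwise more than \<open>0.7 k\<close> apart have perimeter above
    \<open>2.1 k\<close>, but at most \<open>2 k\<close> is possible.\<close>
  then show False
    using card_sym_diff_perimeter[of "{..<k}" "a x" "a y" "a z", OF _ sub sub sub]
      far[of x y] far[of y z] far[of x z] xyz(2-4) by simp
qed

text \<open>Complements are unique, so opposite tails or opposite heads both force the two edges to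
  be inverse to each other. By injectivity \<open>i\<close> and \<open>j\<close> are then successors
  of each other modulo \<open>n\<close>, which requires \<open>n = 2\<close>.\<close>

lemma not_two_full_edges:
  assumes "3 \<le> n" "i < n" "j < n" "i \<noteq> j"
  shows "\<not> (D i = k \<and> D j = k)"
proof
  assume full: "D i = k \<and> D j = k"
  have opposite: "B = C" if "A \<subseteq> {..<k}" "B \<subseteq> {..<k}" "C \<subseteq> {..<k}"
    "k \<le> card (sym_diff A B)" "k \<le> card (sym_diff A C)" for A B C
    using sym_diff_full_unique[of "{..<k}" A B C] that by simp
  have swap: "card (sym_diff A B) = card (sym_diff B A)" for A B :: "nat set"
    by (simp only: Un_commute)
  have S: "a i \<subseteq> {..<k}" "a j \<subseteq> {..<k}" "b i \<subseteq> {..<k}" "b j \<subseteq> {..<k}"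
    using sub sub_b assms by blast+
  have E: "k \<le> card (sym_diff (a i) (b i))" "k \<le> card (sym_diff (a j) (b j))"
    using full by (simp_all add: D_def)
  have "k \<le> card (sym_diff (a i) (a j)) \<or> k \<le> card (sym_diff (b i) (b j))"
    using far_ends[of i j k] full assms by simp
  then have "a j = b i \<and> a i = b j"
  proof
    assume *: "k \<le> card (sym_diff (a i) (a j))"
    show ?thesis
      using opposite[OF S(1,2,3) * E(1)] opposite[OF S(2,1,4) *[unfolded swap[of "a i"]] E(2)] by blast
  next
    assume *: "k \<le> card (sym_diff (b i) (b j))"
    show ?thesis
      using opposite[OF S(3,1,4) E(1)[unfolded swap[of "a i"]] *]
        opposite[OF S(4,2,3) E(2)[unfolded swap[of "a j"]] *[unfolded swap[of "b i"]]] by blast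
  qed
  then have "j = Suc i mod n" "i = Suc j mod n"
    using inj_onD[OF inj, of j "Suc i mod n"] inj_onD[OF inj, of i "Suc j mod n"] assms
    by (simp_all add: b_def)
  then show False
    using assms by (simp add: mod_Suc split: if_splits)
qed

text \<open>Of at most two long edges one is not a full diagonal, so the total is at most
  \<open>1 + 3/4\<close>.\<close>

lemma long_edges:
  assumes "3 \<le> n"
  shows "(\<Sum>i | i < n \<and> 9 * k < 10 * D i. weight k (D i)) \<le> 7/4"
proof -
  define L where "L = {i. i < n \<and> 9 * k < 10 * D i}"
  have le1: "weight k (D i) \<le> 1" if "i \<in> L" for i
    using weight_mono[OF D_le, of i k] that by (simp add: L_def weight_self k_pos)
  have "(\<Sum>i\<in>L. weight k (D i)) \<le> 7/4"
  proof (cases "card L = 2")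
    case True
    then obtain i j where L: "L = {i, j}" "i \<noteq> j"
      by (auto simp: card_2_iff)
    then have ij: "i < n" "j < n" by (auto simp: L_def)
    have "D i \<le> k - 1 \<or> D j \<le> k - 1"
      using not_two_full_edges[OF assms ij L(2)] D_le[of i] D_le[of j] ij by linarith
    then have "weight k (D i) \<le> 3/4 \<or> weight k (D j) \<le> 3/4"
      using weight_mono weight_pred_self[OF k_pos] order_trans by blast
    then show ?thesis
      using L le1[of i] le1[of j] by auto
  next
    case False
    then have "card L \<le> 1"
      using card_long_edges unfolding L_def by linarith
    moreover have "(\<Sum>i\<in>L. weight k (D i)) \<le> real (card L) * 1"
      using le1 by (rule sum_bounded_above)
    ultimately show ?thesis by linarith
  qed
  then show ?thesis by (simp add: L_def)
qed

lemma total_weight: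
  assumes \<eta>: "\<And>p. p \<in> {11/100..45/100} \<Longrightarrow> rate p \<le> - \<eta>" and k: "100 \<le> k"
    and small: "(2 * sqrt (24/100)) ^ k + real (k + 1) ^ 3 * exp (5 - \<eta> * k) \<le> 1/4"
  shows "(\<Sum>i<n. weight k (D i)) \<le> 2"
\<comment> \<open>Two antipodal points attain the bound 2, as their diagonal is counted twice; for
  larger \<open>n\<close> the bound splits as \<open>1/4 + 7/4\<close>.\<close>
proof (cases "n = 2")
  case True
  have "(\<Sum>i<n. weight k (D i)) \<le> real (card {..<n}) * 1"
    using weight_mono[OF D_le, of _ k] by (intro sum_bounded_above) (auto simp: weight_self k_pos)
  then show ?thesis using True by simp
next
  case False
  then have n: "3 \<le> n" using two_le_n by simp
  define S where "S = {i. i < n \<and> 100 * D i \<le> 24 * k}"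
  define M where "M = {i. i < n \<and> 24 * k < 100 * D i \<and> 10 * D i \<le> 9 * k}"
  define L where "L = {i. i < n \<and> 9 * k < 10 * D i}"
  have "{..<n} = S \<union> (M \<union> L)"
    by (auto simp: S_def M_def L_def)
  moreover have "S \<inter> (M \<union> L) = {}" "M \<inter> L = {}"
    using k by (auto simp: S_def M_def L_def)
  moreover have "finite S" "finite M" "finite L"
    by (auto simp: S_def M_def L_def)
  ultimately have "(\<Sum>i<n. weight k (D i))
      = (\<Sum>i\<in>S. weight k (D i)) + ((\<Sum>i\<in>M. weight k (D i)) + (\<Sum>i\<in>L. weight k (D i)))"
    by (simp add: sum.union_disjoint)
  then show ?thesis
    using short_edges medium_edges[OF \<eta> k] long_edges[OF n] small
    unfolding S_def M_def L_def by linarith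
qed

end

section \<open>Optimal tours through vertices of the cube\<close>

definition supp :: "nat \<Rightarrow> (nat \<Rightarrow> real) \<Rightarrow> nat set" where
  "supp k x = {i. i < k \<and> x i = 1}"

lemma inj_on_supp: "inj_on (supp k) (cube_vertices k)"
proof (rule inj_onI)
  fix x y assume xy: "x \<in> cube_vertices k" "y \<in> cube_vertices k" "supp k x = supp k y"
  show "x = y"
  proof (rule PiE_ext)
    show "x i = y i" if "i \<in> {..<k}" for i
    proof -
      have "x i \<in> {0, 1}" "y i \<in> {0, 1}"
        using xy(1,2) that unfolding cube_vertices_def by (blast dest: PiE_mem)+
      moreover have "i \<in> supp k x \<longleftrightarrow> i \<in> supp k y"
        by (simp only: xy(3))
      ultimately show ?thesis
        using that by (auto simp: supp_def)
    qed
  qed (use xy(1,2) in \<open>simp_all only: cube_vertices_def\<close>)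
qed

lemma euclid_dist_eq:
  assumes "x \<in> cube_vertices k" "y \<in> cube_vertices k"
  shows "euclid_dist k x y = sqrt (card (sym_diff (supp k x) (supp k y)))"
proof -
  define S where "S = sym_diff (supp k x) (supp k y)"
  have "(\<Sum>i<k. (x i - y i)\<^sup>2) = (\<Sum>i<k. if i \<in> S then 1 else 0)"
  proof (intro sum.cong)
    fix i assume i: "i \<in> {..<k}"
    then have "x i \<in> {0, 1}" "y i \<in> {0, 1}"
      using assms unfolding cube_vertices_def by (blast dest: PiE_mem)+
    then show "(x i - y i)\<^sup>2 = (if i \<in> S then 1 else 0)"
      using i by (auto simp: S_def supp_def)
  qed simp
  also have "\<dots> = card ({..<k} \<inter> S)"
    by (simp add: sum.If_cases)
  also have "{..<k} \<inter> S = S"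
    by (auto simp: S_def supp_def)
  finally show ?thesis by (simp add: euclid_dist_def L2_set_def S_def)
qed

lemma ex_optimal_tour:
  assumes "finite X"
  obtains H where "distinct H" "set H = X"
    "\<And>H'. distinct H' \<Longrightarrow> set H' = X \<Longrightarrow> tour_cost g H \<le> tour_cost g H'"
proof -
  define T where "T = {H. distinct H \<and> set H = X}"
  have "finite T"
    by (rule finite_subset[OF _ finite_subset_distinct[OF assms]]) (auto simp: T_def)
  moreover have "T \<noteq> {}"
    using finite_distinct_list[OF assms] by (auto simp: T_def)
  ultimately obtain H where "H \<in> T" "\<And>H'. H' \<in> T \<Longrightarrow> tour_cost g H \<le> tour_cost g H'"
    using arg_min_if_finite[of T "tour_cost g"] by (metis linorder_not_le)
  then show ?thesis using that by (auto simp: T_def)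
qed

lemma ex_cycle_scaled_cost_le:
  assumes X: "X \<subseteq> cube_vertices k" "2 \<le> card X"
    and \<eta>: "\<And>p. p \<in> {11/100..45/100} \<Longrightarrow> rate p \<le> - \<eta>" and k: "100 \<le> k"
    and small: "(2 * sqrt (24/100)) ^ k + real (k + 1) ^ 3 * exp (5 - \<eta> * k) \<le> 1/4"
  shows "\<exists>H. hamiltonian_cycle X H \<and> scaled_cost k H \<le> 2 powr (1 / real k) * sqrt (real k)"
proof -
  define g where "g x y = weight k (card (sym_diff (supp k x) (supp k y)))" for x y
  have sym: "g x y = g y x" for x y
    by (simp add: g_def Un_commute)
  have "finite X"
    using X(2) by (metis card.infinite not_numeral_le_zero)
  then obtain H where H: "distinct H" "set H = X"
    and opt: "\<And>H'. distinct H' \<Longrightarrow> set H' = X \<Longrightarrow> tour_cost g H \<le> tour_cost g H'"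
    using ex_optimal_tour[OF \<open>finite X\<close>, of g] by metis
  define n where "n = length H"
  have n: "2 \<le> n"
    using X(2) H distinct_card[of H] by (simp add: n_def)
  have vertex: "H ! i \<in> cube_vertices k" if "i < n" for i
    using that H X(1) nth_mem[of i H] by (auto simp: n_def)
  have le: "g (H ! i) (H ! (Suc i mod n)) + g (H ! j) (H ! (Suc j mod n))
      \<le> g (H ! i) (H ! j) + g (H ! (Suc i mod n)) (H ! (Suc j mod n))"
    if "i < j" "j < n" for i j
    using optimal_tour_two_opt[of g H i j] sym opt H that by (simp add: n_def)
  interpret two_opt_tour k n "\<lambda>i. supp k (H ! i)"
  proof
    show "inj_on (\<lambda>i. supp k (H ! i)) {..<n}"
    proof (rule inj_onI)
      fix i j assume ij: "i \<in> {..<n}" "j \<in> {..<n}" "supp k (H ! i) = supp k (H ! j)"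
      then have "H ! i = H ! j"
        using vertex by (intro inj_onD[OF inj_on_supp]) auto
      then show "i = j"
        using ij H(1) by (simp add: n_def nth_eq_iff_index_eq)
    qed
    show "supp k (H ! i) \<subseteq> {..<k}" for i
      by (auto simp: supp_def)
    fix i j assume "i < n" "j < n" "i \<noteq> j"
    then show "weight k (card (sym_diff (supp k (H ! i)) (supp k (H ! (Suc i mod n)))))
        + weight k (card (sym_diff (supp k (H ! j)) (supp k (H ! (Suc j mod n)))))
      \<le> weight k (card (sym_diff (supp k (H ! i)) (supp k (H ! j))))
        + weight k (card (sym_diff (supp k (H ! (Suc i mod n))) (supp k (H ! (Suc j mod n)))))"
      \<comment> \<open>The exchange inequality was derived for \<open>i < j\<close> only; symmetry
        of \<open>g\<close> covers the other order.\<close>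
      using le[of i j] le[of j i] sym unfolding g_def[symmetric]
      by (cases "i < j") (auto simp: add.commute)
  qed (use k n in auto)
  have edge: "euclid_dist k (H ! i) (H ! (Suc i mod n)) ^ k = sqrt k ^ k * weight k (D i)"
    if "i < n" for i
    using that k n by (simp add: euclid_dist_eq vertex weight_def D_def b_def real_sqrt_divide power_divide)
  have "(\<Sum>i<length H. euclid_dist k (H ! i) (H ! (Suc i mod length H)) ^ k)
      = sqrt k ^ k * (\<Sum>i<n. weight k (D i))"
    using edge by (simp add: n_def sum_distrib_left)
  also have "\<dots> \<le> sqrt k ^ k * 2"
    using total_weight[OF \<eta> k small] by (intro mult_left_mono) auto
  finally have "scaled_cost k H \<le> (sqrt k ^ k * 2) powr (1 / k)"
    unfolding scaled_cost_def
    by (intro powr_mono2) (auto intro!: sum_nonneg simp: euclid_dist_def L2_set_nonneg)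
  also have "\<dots> = 2 powr (1 / k) * sqrt k"
  proof -
    have "(sqrt k ^ k) powr (1 / k) = sqrt k"
      using k by (simp add: powr_realpow[symmetric] powr_powr)
    then show ?thesis by (simp add: powr_mult)
  qed
  finally show ?thesis
    using H X by (auto simp: hamiltonian_cycle_def)
qed

section \<open>Choice of the threshold for the dimension\<close>

theorem theorem1p4:
  "\<exists>k\<^sub>0::nat. \<forall>k\<ge>k\<^sub>0. \<forall>X\<subseteq>cube_vertices k. 2 \<le> card X \<longrightarrow>
     (\<exists>H. hamiltonian_cycle X H \<and> scaled_cost k H \<le> 2 powr (1 / real k) * sqrt (real k))"
proof -
  obtain \<eta> where \<eta>: "0 < \<eta>" "\<And>p. p \<in> {11/100..45/100} \<Longrightarrow> rate p \<le> - \<eta>"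
    using rate_bound by blast
  have "2 * sqrt (24/100) < 1"
    using real_sqrt_less_mono[of "24/100" "1/4"] by (simp add: real_sqrt_divide)
  then have "(\<lambda>k. (2 * sqrt (24/100)) ^ k) \<longlonglongrightarrow> 0"
    by (intro LIMSEQ_realpow_zero) auto
  moreover have "(\<lambda>k. real (k + 1) ^ 3 * exp (5 - \<eta> * real k)) \<longlonglongrightarrow> 0"
    using \<eta>(1) by real_asymp
  ultimately have "(\<lambda>k. (2 * sqrt (24/100)) ^ k + real (k + 1) ^ 3 * exp (5 - \<eta> * real k)) \<longlonglongrightarrow> 0"
    using tendsto_add by fastforce
  then have "\<forall>\<^sub>F k in sequentially.
      (2 * sqrt (24/100)) ^ k + real (k + 1) ^ 3 * exp (5 - \<eta> * real k) < 1/4"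
    by (rule order_tendstoD) simp
  then obtain K where "\<And>k. K \<le> k \<Longrightarrow>
      (2 * sqrt (24/100)) ^ k + real (k + 1) ^ 3 * exp (5 - \<eta> * real k) < 1/4"
    by (auto simp: eventually_sequentially)
  \<comment> \<open>\<open>K\<close> makes the exponentially small terms at most \<open>1/4\<close>;
    the value 100 absorbs the rounding of the packing radius.\<close>
  then show ?thesis
    using ex_cycle_scaled_cost_le[OF _ _ \<eta>(2)]
    by (intro exI[of _ "max K 100"]) (auto simp: less_imp_le)
qed

end
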